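(* Let $n\ge 1$, let $G=(V,E)$ be a finite simple graph on $n$ vertices with no isolated vertices, let $\ell:V\to\{0,1\}$, and let $x\in(0,2)$. Let $R$ be chosen uniformly at random from the $2^n$ subsets of $V$. Then $\mathbb{E}[|R|]=n/2$, $\mathbb{E}[z_\ell(R)]=n/4$, and $$M_{\ell,x}(G)>x^{n/2}(4-x^2)^{n/4}.$$
   Context: For $S\subseteq V$ and $v\in V$ write $d_S(v):=|N_G(v)\cap S|$, where $N_G(v)$ is the set of neighbours of $v$ in $G$. Given $\ell:V\to\{0,1\}$, a set $S\subseteq V$ is called $\ell$-admissible if $d_S(v)\equiv \ell(v)\pmod 2$ for every $v\in S$; the empty set is regarded as $\ell$-admissible. Let $\mathcal{A}_\ell(G)$ be the collection of all $\ell$-admissible sets $S\subseteq V$. For $x\in\mathbb{R}$ define $$M_{\ell,x}(G):=\sum_{S\in\mathcal{A}_\ell(G)}x^{|S|}.$$ For $R\subseteq V$ define $$z_\ell(R):=\bigl|\{v\in V\setminus R: d_R(v)\equiv\ell(v)\pmod 2\}\bigr|.$$ *)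

theory Defs
  imports "HOL-Probability.Probability" "HOL-Number_Theory.Cong" "Graph_Theory.Pair_Digraph"
begin

text \<open>
  A finite simple graph is a \<open>pair_graph\<close>: a finite vertex set with a symmetric,
  irreflexive set of arcs, each undirected edge being represented by its two orientations.
\<close>

definition neighbours :: "'a pair_pre_digraph \<Rightarrow> 'a \<Rightarrow> 'a set" where
  "neighbours G v = {u \<in> pverts G. (v, u) \<in> parcs G}"

definition no_isolated_vertices :: "'a pair_pre_digraph \<Rightarrow> bool" where
  "no_isolated_vertices G \<longleftrightarrow> (\<forall>v \<in> pverts G. neighbours G v \<noteq> {})"

definition deg_in :: "'a pair_pre_digraph \<Rightarrow> 'a set \<Rightarrow> 'a \<Rightarrow> nat" where
  "deg_in G S v = card (neighbours G v \<inter> S)"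

definition admissible :: "'a pair_pre_digraph \<Rightarrow> ('a \<Rightarrow> nat) \<Rightarrow> 'a set \<Rightarrow> bool" where
  "admissible G l S \<longleftrightarrow> S \<subseteq> pverts G \<and> (\<forall>v \<in> S. [deg_in G S v = l v] (mod 2))"

definition admissible_sets :: "'a pair_pre_digraph \<Rightarrow> ('a \<Rightarrow> nat) \<Rightarrow> 'a set set" where
  "admissible_sets G l = {S. admissible G l S}"

definition admissible_gf :: "'a pair_pre_digraph \<Rightarrow> ('a \<Rightarrow> nat) \<Rightarrow> real \<Rightarrow> real" where
  "admissible_gf G l x = (\<Sum>S \<in> admissible_sets G l. x ^ card S)"

definition z_count :: "'a pair_pre_digraph \<Rightarrow> ('a \<Rightarrow> nat) \<Rightarrow> 'a set \<Rightarrow> nat" where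
  "z_count G l R = card {v \<in> pverts G - R. [deg_in G R v = l v] (mod 2)}"

definition random_subset :: "'a pair_pre_digraph \<Rightarrow> 'a set pmf" where
  "random_subset G = pmf_of_set (Pow (pverts G))"

end

theory Submission
  imports Defs
begin

text \<open>
  Put \<open>y = x / 2\<close>. The condition that \<open>S\<close> is admissible is detected by the product of
  \<open>(1 + (-1)^(l v + d_S v)) / 2\<close> over \<open>v \<in> S\<close>. Expanding it gives a sum over
  \<open>T \<subseteq> S\<close> of signs, in which the arcs inside \<open>T\<close> cancel because each edge of \<open>T\<close> is
  counted in both directions. Only the edges between \<open>T\<close> and \<open>R = S - T\<close> remain, and these enter
  multiplicatively in \<open>T\<close> for fixed \<open>R\<close>. Summing over \<open>T \<subseteq> V - R\<close> first therefore yields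
  the identity \<open>admissible_gf_eq_sum_weight\<close>,

    \<open>M(G) = \<Sum>R \<subseteq> V. y^|R| (1 + y)^(z R) (1 - y)^(n - |R| - z R)\<close>,

  whose terms are all positive because \<open>0 < y < 1\<close>.

  By the inequality of arithmetic and geometric means (\<open>sum_gt_card_mult_exp_mean\<close>), the
  right-hand side is at least \<open>2^n\<close> times the exponential of the average logarithm of the terms.
  That logarithm is affine in \<open>|R|\<close> and \<open>z R\<close>, so its average only depends on the two
  expectations \<open>n / 2\<close> and \<open>n / 4\<close>. The first comes from complementation. For the second, a
  vertex \<open>v\<close> outside \<open>R\<close> has a neighbour, so the sign \<open>(-1)^(d_R v)\<close> averages to zero over
  \<open>R \<subseteq> V - {v}\<close>. The resulting bound is exactly \<open>x^(n/2) (4 - x^2)^(n/4)\<close>.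

  It is strict because the terms cannot all equal their geometric mean: for \<open>R = V\<close> this would
  say \<open>y^2 = 1 - y^2\<close>, and comparing with \<open>R = V - {v}\<close> would give \<open>y = 1 - y\<close>.
\<close>

section \<open>Parity signs\<close>

definition edge_sign :: "'a pair_pre_digraph \<Rightarrow> 'a \<Rightarrow> 'a \<Rightarrow> real" where
  "edge_sign G v u = (if (v, u) \<in> parcs G then - 1 else 1)"

definition parity_sign :: "'a pair_pre_digraph \<Rightarrow> ('a \<Rightarrow> nat) \<Rightarrow> 'a set \<Rightarrow> 'a \<Rightarrow> real" where
  "parity_sign G l R v = (- 1) ^ l v * (\<Prod>u\<in>R. edge_sign G v u)"

lemma prod_edge_sign_eq_power_deg_in:
  assumes "finite R" "R \<subseteq> pverts G"
  shows "(\<Prod>u\<in>R. edge_sign G v u) = (- 1) ^ deg_in G R v"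
proof -
  have *: "neighbours G v \<inter> R = {u \<in> R. (v, u) \<in> parcs G}"
    using assms(2) by (auto simp: neighbours_def)
  have "(\<Prod>u\<in>R. edge_sign G v u) = (\<Prod>u\<in>{u \<in> R. (v, u) \<in> parcs G}. - 1)"
    unfolding edge_sign_def using assms(1) by (simp add: prod.If_cases Int_def)
  then show ?thesis by (simp add: deg_in_def *)
qed

lemma parity_sign_eq_if_cong:
  assumes "finite R" "R \<subseteq> pverts G"
  shows "parity_sign G l R v = (if [deg_in G R v = l v] (mod 2) then 1 else - 1)"
proof -
  have "[deg_in G R v = l v] (mod 2) \<longleftrightarrow> even (l v + deg_in G R v)"
    unfolding cong_def by presburger
  then show ?thesis
    by (simp add: parity_sign_def prod_edge_sign_eq_power_deg_in[OF assms] flip: power_add)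
qed

text \<open>
  The pair \<open>(v, u)\<close> and its reverse contribute equal signs, so everything cancels except the
  diagonal, which is trivial because there are no loops.
\<close>

lemma prod_edge_sign_square_eq_one:
  assumes "pair_graph G" "finite T"
  shows "(\<Prod>v\<in>T. \<Prod>u\<in>T. edge_sign G v u) = 1"
  using assms(2)
proof (induction T)
  case (insert a T)
  interpret pair_graph G by fact
  have sym: "(\<Prod>u\<in>T. edge_sign G u a) = (\<Prod>u\<in>T. edge_sign G a u)"
    unfolding edge_sign_def using arcs_symmetric by (intro prod.cong) auto
  have loop: "edge_sign G a a = 1"
    unfolding edge_sign_def using no_loops[of "(a, a)"] by auto
  have "(\<Prod>u\<in>T. edge_sign G a u) * (\<Prod>u\<in>T. edge_sign G a u) = 1"
    by (subst prod.distrib[symmetric], rule prod.neutral) (auto simp: edge_sign_def)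
  with insert show ?case
    by (simp add: prod.distrib sym loop mult.assoc)
qed simp

lemma sum_Pow_prod_eq_prod_one_plus:
  fixes f :: "'a \<Rightarrow> real"
  assumes "finite A"
  shows "(\<Sum>T\<in>Pow A. prod f T) = (\<Prod>v\<in>A. 1 + f v)"
  using prod_add[OF assms, of f "\<lambda>_. 1"] by (simp add: add.commute)

section \<open>The generating function as a sum over all vertex sets\<close>

definition weight :: "'a pair_pre_digraph \<Rightarrow> ('a \<Rightarrow> nat) \<Rightarrow> real \<Rightarrow> 'a set \<Rightarrow> real" where
  "weight G l y R = y ^ card R * (\<Prod>v\<in>pverts G - R. 1 + y * parity_sign G l R v)"

lemma sum_disjoint_pairs_eq_sum_nested_pairs:
  assumes "finite V"
  shows "(\<Sum>R\<in>Pow V. \<Sum>T\<in>Pow (V - R). f R T) = (\<Sum>S\<in>Pow V. \<Sum>T\<in>Pow S. f (S - T) T)"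
proof -
  have "(\<Sum>R\<in>Pow V. \<Sum>T\<in>Pow (V - R). f R T) = (\<Sum>(R, T)\<in>(SIGMA R:Pow V. Pow (V - R)). f R T)"
    using assms by (subst sum.Sigma) auto
  also have "\<dots> = (\<Sum>(S, T)\<in>(SIGMA S:Pow V. Pow S). f (S - T) T)"
    by (rule sum.reindex_bij_witness[of _ "\<lambda>(S, T). (S - T, T)" "\<lambda>(R, T). (R \<union> T, T)"])
       (auto intro!: arg_cong2[where f = f])
  also have "\<dots> = (\<Sum>S\<in>Pow V. \<Sum>T\<in>Pow S. f (S - T) T)"
    using assms by (subst sum.Sigma) (auto intro: finite_subset)
  finally show ?thesis .
qed

text \<open>
  Expanding the product for \<open>S\<close> over \<open>T \<subseteq> S\<close>, the sign of the arcs from \<open>T\<close> into \<open>S\<close> equals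
  that of the arcs from \<open>T\<close> into \<open>S - T\<close>, which makes it multiplicative in \<open>T\<close> once
  \<open>R = S - T\<close> is fixed.
\<close>

lemma admissible_gf_eq_sum_weight:
  assumes "pair_graph G"
  shows "admissible_gf G l (2 * y) = (\<Sum>R\<in>Pow (pverts G). weight G l y R)"
proof -
  interpret pair_graph G by fact
  let ?V = "pverts G"
  have fin: "finite S" if "S \<subseteq> ?V" for S
    using that finite_verts finite_subset by blast
  have indicator: "(\<Prod>v\<in>S. 1 + parity_sign G l S v) = (if admissible G l S then 2 ^ card S else 0)"
    if S: "S \<subseteq> ?V" for S
  proof (cases "admissible G l S")
    case True
    then have "(\<Prod>v\<in>S. 1 + parity_sign G l S v) = (\<Prod>v\<in>S. 2)"
      by (intro prod.cong) (auto simp: admissible_def parity_sign_eq_if_cong[OF fin[OF S] S])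
    then show ?thesis using True by simp
  next
    case False
    then obtain v where "v \<in> S" "\<not> [deg_in G S v = l v] (mod 2)"
      using S unfolding admissible_def by blast
    then show ?thesis using False fin[OF S]
      by (auto simp: parity_sign_eq_if_cong[OF fin[OF S] S] intro!: prod_zero)
  qed
  \<comment> \<open>The arcs inside \<open>T\<close> cancel, so \<open>T\<close> only interacts with \<open>S - T\<close>.\<close>
  have shrink: "(\<Prod>v\<in>T. parity_sign G l S v) = (\<Prod>v\<in>T. parity_sign G l (S - T) v)"
    if "S \<subseteq> ?V" "T \<subseteq> S" for S T
  proof -
    have "(\<Prod>u\<in>S. edge_sign G v u)
        = (\<Prod>u\<in>S - T. edge_sign G v u) * (\<Prod>u\<in>T. edge_sign G v u)" for v
      by (rule prod.subset_diff) (use that fin in auto)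
    moreover have "(\<Prod>v\<in>T. \<Prod>u\<in>T. edge_sign G v u) = 1"
      using prod_edge_sign_square_eq_one[OF assms] fin that by blast
    ultimately show ?thesis
      by (simp add: parity_sign_def prod.distrib)
  qed
  have "(\<Sum>R\<in>Pow ?V. weight G l y R)
      = (\<Sum>R\<in>Pow ?V. \<Sum>T\<in>Pow (?V - R). y ^ card R * (\<Prod>v\<in>T. y * parity_sign G l R v))"
    unfolding weight_def
    by (simp add: sum_Pow_prod_eq_prod_one_plus[symmetric] sum_distrib_left)
  also have "\<dots> = (\<Sum>S\<in>Pow ?V. \<Sum>T\<in>Pow S.
      y ^ card (S - T) * (\<Prod>v\<in>T. y * parity_sign G l (S - T) v))"
    by (rule sum_disjoint_pairs_eq_sum_nested_pairs) simp
  also have "\<dots> = (\<Sum>S\<in>Pow ?V. \<Sum>T\<in>Pow S. y ^ card S * (\<Prod>v\<in>T. parity_sign G l S v))"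
  proof (intro sum.cong refl)
    fix S T assume "S \<in> Pow ?V" "T \<in> Pow S"
    then have ST: "S \<subseteq> ?V" "T \<subseteq> S" by auto
    then have "card S = card (S - T) + card T"
      using fin[OF ST(1)] by (simp add: card_Diff_subset card_mono finite_subset)
    then show "y ^ card (S - T) * (\<Prod>v\<in>T. y * parity_sign G l (S - T) v)
        = y ^ card S * (\<Prod>v\<in>T. parity_sign G l S v)"
      by (simp add: shrink[OF ST] prod.distrib power_add)
  qed
  also have "\<dots> = (\<Sum>S\<in>Pow ?V. y ^ card S * (if admissible G l S then 2 ^ card S else 0))"
    using fin by (simp add: indicator[symmetric] sum_Pow_prod_eq_prod_one_plus sum_distrib_left[symmetric])
  also have "\<dots> = (\<Sum>S\<in>Pow ?V. if admissible G l S then (2 * y) ^ card S else 0)"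
    by (intro sum.cong) (auto simp: power_mult_distrib)
  also have "\<dots> = (\<Sum>S\<in>{S \<in> Pow ?V. admissible G l S}. (2 * y) ^ card S)"
    by (rule sum.inter_filter[symmetric]) simp
  also have "{S \<in> Pow ?V. admissible G l S} = admissible_sets G l"
    by (auto simp: admissible_sets_def admissible_def)
  finally show ?thesis by (simp add: admissible_gf_def)
qed

lemma weight_eq_powers:
  assumes "finite (pverts G)" "R \<subseteq> pverts G"
  shows "weight G l y R = y ^ card R * (1 + y) ^ z_count G l R
    * (1 - y) ^ (card (pverts G) - card R - z_count G l R)"
proof -
  define A where "A = pverts G - R"
  define C where "C = {v \<in> A. [deg_in G R v = l v] (mod 2)}"
  have finR: "finite R" and finA: "finite A"
    using finite_subset[OF assms(2,1)] assms(1) by (simp_all add: A_def)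
  have C: "C \<subseteq> A" by (auto simp: C_def)
  have "(\<Prod>v\<in>A. 1 + y * parity_sign G l R v)
      = (\<Prod>v\<in>A - C. 1 + y * parity_sign G l R v) * (\<Prod>v\<in>C. 1 + y * parity_sign G l R v)"
    using C finA by (rule prod.subset_diff)
  moreover have "(\<Prod>v\<in>A - C. 1 + y * parity_sign G l R v) = (\<Prod>v\<in>A - C. 1 - y)"
    by (rule prod.cong) (simp_all add: parity_sign_eq_if_cong[OF finR assms(2)] C_def)
  moreover have "(\<Prod>v\<in>C. 1 + y * parity_sign G l R v) = (\<Prod>v\<in>C. 1 + y)"
    by (rule prod.cong) (simp_all add: parity_sign_eq_if_cong[OF finR assms(2)] C_def)
  moreover have "card (A - C) = card (pverts G) - card R - card C"
    using card_Diff_subset[OF finite_subset[OF C finA] C] card_Diff_subset[OF finR assms(2)]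
    by (simp add: A_def)
  moreover have "z_count G l R = card C"
    by (simp add: z_count_def C_def A_def)
  ultimately show ?thesis
    unfolding weight_def A_def[symmetric] by simp
qed

text \<open>
  This makes the truncated subtraction in the last exponent of \<open>weight_eq_powers\<close> an exact one.
\<close>

lemma z_count_le:
  assumes "finite (pverts G)" "R \<subseteq> pverts G"
  shows "card R + z_count G l R \<le> card (pverts G)"
proof -
  have "z_count G l R \<le> card (pverts G - R)"
    unfolding z_count_def using assms(1) by (intro card_mono) auto
  moreover have "card (pverts G - R) = card (pverts G) - card R"
    using card_Diff_subset[OF finite_subset[OF assms(2,1)] assms(2)] .
  moreover have "card R \<le> card (pverts G)"
    using assms by (simp add: card_mono)
  ultimately show ?thesis by simp
qed

section \<open>The two expectations\<close>

lemma sum_card_Pow: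
  assumes "finite V"
  shows "(\<Sum>R\<in>Pow V. real (card R)) = real (card V) / 2 * 2 ^ card V"
proof -
  have "(\<Sum>R\<in>Pow V. real (card R)) = (\<Sum>R\<in>Pow V. real (card (V - R)))"
    by (rule sum.reindex_bij_witness[of _ "\<lambda>R. V - R" "\<lambda>R. V - R"]) (auto simp: double_diff)
  also have "\<dots> = (\<Sum>R\<in>Pow V. real (card V) - real (card R))"
    using assms by (intro sum.cong refl)
      (auto simp: card_Diff_subset card_mono finite_subset of_nat_diff)
  finally show ?thesis
    using assms by (simp add: sum_subtractf card_Pow mult.commute)
qed

text \<open>
  The sign average factors over the elements of \<open>A\<close>, and a neighbour of \<open>v\<close> contributes the
  factor \<open>1 + (-1) = 0\<close>.
\<close>

lemma sum_parity_sign_eq_zero: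
  assumes "finite A" "u \<in> A" "(v, u) \<in> parcs G"
  shows "(\<Sum>R\<in>Pow A. parity_sign G l R v) = 0"
proof -
  have "(\<Sum>R\<in>Pow A. parity_sign G l R v) = (- 1) ^ l v * (\<Prod>u\<in>A. 1 + edge_sign G v u)"
    by (simp add: parity_sign_def sum_distrib_left[symmetric] sum_Pow_prod_eq_prod_one_plus[OF assms(1)])
  also have "(\<Prod>u\<in>A. 1 + edge_sign G v u) = 0"
    using assms by (intro prod_zero) (auto simp: edge_sign_def)
  finally show ?thesis by simp
qed

lemma sum_z_count_Pow:
  assumes "pair_graph G" "no_isolated_vertices G"
  shows "(\<Sum>R\<in>Pow (pverts G). real (z_count G l R))
    = real (card (pverts G)) / 4 * 2 ^ card (pverts G)"
proof -
  interpret pair_graph G by fact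
  let ?V = "pverts G"
  have z: "real (z_count G l R) = (\<Sum>v\<in>?V. if v \<notin> R then (1 + parity_sign G l R v) / 2 else 0)"
    if R: "R \<subseteq> ?V" for R
  proof -
    have fin: "finite R" using R finite_verts finite_subset by blast
    have "real (z_count G l R) = (\<Sum>v\<in>{v \<in> ?V - R. [deg_in G R v = l v] (mod 2)}. 1)"
      by (simp add: z_count_def)
    also have "\<dots> = (\<Sum>v\<in>?V. if v \<notin> R \<and> [deg_in G R v = l v] (mod 2) then 1 else 0)"
      by (subst sum.inter_filter[symmetric]) (auto intro!: sum.cong)
    also have "\<dots> = (\<Sum>v\<in>?V. if v \<notin> R then (1 + parity_sign G l R v) / 2 else 0)"
      by (intro sum.cong) (auto simp: parity_sign_eq_if_cong[OF fin R])
    finally show ?thesis .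
  qed
  \<comment> \<open>Half of the sets avoid \<open>v\<close>, and half of those have the prescribed parity at \<open>v\<close>.\<close>
  have per_vertex: "(\<Sum>R\<in>Pow ?V. if v \<notin> R then (1 + parity_sign G l R v) / 2 else 0)
      = 2 ^ card ?V / 4" if v: "v \<in> ?V" for v
  proof -
    obtain u where u: "u \<in> ?V" "(v, u) \<in> parcs G"
      using assms(2) v by (auto simp: no_isolated_vertices_def neighbours_def)
    have "u \<noteq> v" using u no_loops[of "(v, u)"] by auto
    have "(\<Sum>R\<in>Pow ?V. if v \<notin> R then (1 + parity_sign G l R v) / 2 else 0)
        = (\<Sum>R\<in>{R \<in> Pow ?V. v \<notin> R}. (1 + parity_sign G l R v) / 2)"
      by (rule sum.inter_filter[symmetric]) simp
    also have "{R \<in> Pow ?V. v \<notin> R} = Pow (?V - {v})" by auto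
    also have "(\<Sum>R\<in>Pow (?V - {v}). (1 + parity_sign G l R v) / 2)
        = (2 ^ card (?V - {v}) + (\<Sum>R\<in>Pow (?V - {v}). parity_sign G l R v)) / 2"
      by (simp add: sum_divide_distrib[symmetric] sum.distrib card_Pow)
    also have "(\<Sum>R\<in>Pow (?V - {v}). parity_sign G l R v) = 0"
      using u \<open>u \<noteq> v\<close> by (intro sum_parity_sign_eq_zero[of _ u]) auto
    also have "card ?V = Suc (card (?V - {v}))"
      using v by (simp add: card_Suc_Diff1 del: card_Diff_insert)
    ultimately show ?thesis by simp
  qed
  have "(\<Sum>R\<in>Pow ?V. real (z_count G l R))
      = (\<Sum>R\<in>Pow ?V. \<Sum>v\<in>?V. if v \<notin> R then (1 + parity_sign G l R v) / 2 else 0)"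
    using z by (intro sum.cong) auto
  also have "\<dots> = (\<Sum>v\<in>?V. \<Sum>R\<in>Pow ?V. if v \<notin> R then (1 + parity_sign G l R v) / 2 else 0)"
    by (rule sum.swap)
  also have "\<dots> = (\<Sum>v\<in>?V. 2 ^ card ?V / 4)"
    using per_vertex by (intro sum.cong) auto
  finally show ?thesis by simp
qed

lemma expectation_random_subset:
  fixes f :: "'a set \<Rightarrow> real"
  assumes "finite (pverts G)"
  shows "measure_pmf.expectation (random_subset G) f = (\<Sum>R\<in>Pow (pverts G). f R) / 2 ^ card (pverts G)"
  unfolding random_subset_def using assms
  by (subst integral_pmf_of_set) (auto simp: card_Pow)

section \<open>The strict inequality\<close>

text \<open>
  The graph of \<open>exp\<close> lies above its tangent at the mean \<open>m\<close> and touches it only there, and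
  the linear terms of the tangent cancel in the sum.
\<close>

lemma sum_gt_card_mult_exp_mean:
  fixes f :: "'b \<Rightarrow> real"
  assumes "finite A" "a \<in> A" "f a \<noteq> m" "(\<Sum>i\<in>A. f i) = m * real (card A)"
  shows "real (card A) * exp m < (\<Sum>i\<in>A. exp (f i))"
proof -
  have tangent: "exp m * (1 + (f i - m)) \<le> exp (f i)" for i
    using mult_left_mono[OF exp_ge_add_one_self[of "f i - m"], of "exp m"]
    by (simp add: exp_add[symmetric])
  have "1 + (f a - m) < exp (f a - m)"
    using exp_ge_add_one_self[of "f a - m"] assms(3) exp_eq_one_iff
    by (smt (verit) ln_exp ln_le_minus_one ln_eq_minus_one exp_gt_zero)
  from mult_strict_left_mono[OF this, of "exp m"]
  have strict: "exp m * (1 + (f a - m)) < exp (f a)"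
    by (simp add: exp_add[symmetric])
  have "real (card A) * exp m = (\<Sum>i\<in>A. exp m * (1 + (f i - m)))"
    by (simp add: sum_distrib_left[symmetric] sum.distrib sum_subtractf assms(4))
  also have "\<dots> < (\<Sum>i\<in>A. exp (f i))"
    using assms(1,2) tangent strict by (intro sum_strict_mono_ex1) auto
  finally show ?thesis .
qed

theorem theorem2p2:
  fixes G :: "'a pair_pre_digraph" and n :: nat and l :: "'a \<Rightarrow> nat" and x :: real
  assumes "n \<ge> 1"
    and "pair_graph G"
    and "card (pverts G) = n"
    and "no_isolated_vertices G"
    and "l \<in> pverts G \<rightarrow> {0, 1}"
    and "0 < x" and "x < 2"
  shows "measure_pmf.expectation (random_subset G) (\<lambda>R. real (card R)) = real n / 2
    \<and> measure_pmf.expectation (random_subset G) (\<lambda>R. real (z_count G l R)) = real n / 4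
    \<and> admissible_gf G l x > x powr (real n / 2) * (4 - x ^ 2) powr (real n / 4)"
proof (intro conjI)
  interpret pair_graph G by fact
  let ?V = "pverts G"
  note sum_card = sum_card_Pow[OF finite_verts, unfolded assms(3)]
  note sum_z = sum_z_count_Pow[OF assms(2,4), of l, unfolded assms(3)]
  show "measure_pmf.expectation (random_subset G) (\<lambda>R. real (card R)) = real n / 2"
    by (simp add: expectation_random_subset sum_card_Pow assms(3))
  show "measure_pmf.expectation (random_subset G) (\<lambda>R. real (z_count G l R)) = real n / 4"
    by (simp add: expectation_random_subset sum_z assms(3))

  define y where "y = x / 2"
  have y: "0 < y" "y < 1" and x_eq: "x = 2 * y" using assms(6,7) by (auto simp: y_def)
  \<comment> \<open>\<open>L R\<close> is the logarithm of the weight of \<open>R\<close>, and \<open>m\<close> is its average over all \<open>R\<close>: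
    on average \<open>|R| = n / 2\<close>, while \<open>z R\<close> and \<open>n - |R| - z R\<close> are both \<open>n / 4\<close>.\<close>
  define a b c where "a = ln y" and "b = ln (1 + y)" and "c = ln (1 - y)"
  define L where "L R = real (card R) * a + real (z_count G l R) * b
      + (real n - real (card R) - real (z_count G l R)) * c" for R
  define m where "m = real n / 2 * a + real n / 4 * b + real n / 4 * c"
  have weight_eq: "weight G l y R = exp (L R)" if "R \<subseteq> ?V" for R
  proof -
    have "real (n - card R - z_count G l R) = real n - real (card R) - real (z_count G l R)"
      using z_count_le[OF finite_verts that, of l] assms(3) by linarith
    then show ?thesis
      using y by (simp add: weight_eq_powers[OF finite_verts that] assms(3) L_def exp_add
          a_def b_def c_def exp_of_nat_mult flip: \<open>real (n - card R - z_count G l R) = _\<close>)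
  qed
  have "(\<Sum>R\<in>Pow ?V. L R) = (\<Sum>R\<in>Pow ?V. real (card R)) * a + (\<Sum>R\<in>Pow ?V. real (z_count G l R)) * b
      + (real n * 2 ^ n - (\<Sum>R\<in>Pow ?V. real (card R)) - (\<Sum>R\<in>Pow ?V. real (z_count G l R))) * c"
    unfolding L_def sum.distrib sum_distrib_right[symmetric] sum_subtractf
    by (simp add: card_Pow assms(3))
  also have "\<dots> = m * real (card (Pow ?V))"
    unfolding sum_card sum_z by (simp add: m_def card_Pow assms(3) field_simps)
  finally have mean: "(\<Sum>R\<in>Pow ?V. L R) = m * real (card (Pow ?V))" .

  \<comment> \<open>If all weights were equal, \<open>V\<close> would force \<open>y^2 = 1 / 2\<close> and removing one vertex
    \<open>y = 1 / 2\<close>.\<close>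
  have "\<exists>R\<in>Pow ?V. L R \<noteq> m"
  proof (rule ccontr)
    assume "\<not> ?thesis"
    then have const: "L R = m" if "R \<subseteq> ?V" for R using that by auto
    have LV: "L ?V = real n * a"
      by (simp add: L_def z_count_def assms(3))
    then have "real n * (2 * a) = real n * (b + c)"
      using const[of ?V] by (simp add: m_def algebra_simps)
    then have "2 * a = b + c"
      using assms(1) by simp
    then have "exp (2 * a) = exp (b + c)" by simp
    then have "y ^ 2 = (1 + y) * (1 - y)"
      using y by (simp add: a_def b_def c_def exp_add exp_double)
    then have sq: "y * y = 1 / 2" by (simp add: power2_eq_square algebra_simps)
    obtain v where v: "v \<in> ?V" using assms(1,3) by fastforce
    let ?R = "?V - {v}"
    have "weight G l y ?V = weight G l y ?R"
      using const weight_eq by simp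
    moreover have "weight G l y ?V = y ^ card ?R * y"
      using v card_Suc_Diff1[OF finite_verts v] by (simp add: weight_def flip: power_Suc2)
    moreover have "weight G l y ?R = y ^ card ?R * (1 + y * parity_sign G l ?R v)"
      using v by (simp add: weight_def double_diff del: card_Diff_insert)
    ultimately have "y = 1 + y * parity_sign G l ?R v" using y by simp
    moreover have "parity_sign G l ?R v = 1 \<or> parity_sign G l ?R v = - 1"
      by (subst (1 2) parity_sign_eq_if_cong) auto
    ultimately have "y = 1 / 2" by auto
    with sq show False by simp
  qed
  then obtain R0 where R0: "R0 \<in> Pow ?V" "L R0 \<noteq> m" by blast
  have "real (card (Pow ?V)) * exp m < (\<Sum>R\<in>Pow ?V. exp (L R))"
    using sum_gt_card_mult_exp_mean[OF _ R0 mean] by simp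
  also have "\<dots> = admissible_gf G l x"
    unfolding x_eq admissible_gf_eq_sum_weight[OF assms(2)]
    using weight_eq by (intro sum.cong) auto
  also have "real (card (Pow ?V)) * exp m = x powr (real n / 2) * (4 - x ^ 2) powr (real n / 4)"
  proof -
    have "4 - x ^ 2 = 2 * 2 * ((1 + y) * (1 - y))"
      by (simp add: x_eq power2_eq_square algebra_simps)
    then have "ln (4 - x ^ 2) = 2 * ln 2 + b + c" "4 - x ^ 2 > 0"
      using y ln_mult[of 2 "2 :: real"] by (simp_all add: ln_mult b_def c_def)
    moreover have "ln x = ln 2 + a" using y by (simp add: x_eq ln_mult a_def)
    moreover have "real n / 2 * (ln 2 + a) + real n / 4 * (2 * ln 2 + b + c) = real n * ln 2 + m"
      by (simp add: m_def field_simps)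
    ultimately have "x powr (real n / 2) * (4 - x ^ 2) powr (real n / 4) = exp (real n * ln 2 + m)"
      using assms(6) by (simp add: powr_def flip: exp_add)
    also have "\<dots> = 2 ^ n * exp m"
      by (simp add: exp_add exp_of_nat_mult)
    finally show ?thesis by (simp add: card_Pow assms(3))
  qed
  finally show "admissible_gf G l x > x powr (real n / 2) * (4 - x ^ 2) powr (real n / 4)" .
qed

end
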